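(* Let $G$ be a graph with no isolated vertices. Then $i_{dR}(G)\le i_{\{R2\}}(G)+\beta'(G)$, and this bound is sharp.
   Context: $\beta'(G)$ is the minimum cardinality of an edge cover of $G$ (a set of edges such that every vertex is incident to at least one of them). An independent double Roman dominating function (IDRDF) on $G=(V,E)$ is a function $f:V\to\{0,1,2,3\}$ such that: every vertex $v$ with $f(v)=0$ has at least two neighbors $w$ with $f(w)=2$ or at least one neighbor $w$ with $f(w)=3$; every vertex $v$ with $f(v)=1$ has a neighbor $w$ with $f(w)\ge 2$; and $\{v: f(v)>0\}$ is independent. $i_{dR}(G)$ is the minimum weight $\sum_v f(v)$ of an IDRDF on $G$. A Roman $\{2\}$-dominating function is a function $g:V\to\{0,1,2\}$ such that every $v$ with $g(v)=0$ satisfies $\sum_{u\in N(v)}g(u)\ge 2$; it is independent if $\{v:g(v)>0\}$ is independent. $i_{\{R2\}}(G)$ is the minimum weight of an independent Roman $\{2\}$-dominating function on $G$. *)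

theory Defs
  imports Main
begin

definition fin_graph :: "'a set \<Rightarrow> 'a set set \<Rightarrow> bool" where
  "fin_graph V E \<longleftrightarrow> finite V \<and> (\<forall>e\<in>E. e \<subseteq> V \<and> card e = 2)"

definition nbrs :: "'a set set \<Rightarrow> 'a \<Rightarrow> 'a set" where
  "nbrs E v = {w. {v, w} \<in> E}"

definition no_isolated :: "'a set \<Rightarrow> 'a set set \<Rightarrow> bool" where
  "no_isolated V E \<longleftrightarrow> (\<forall>v\<in>V. nbrs E v \<noteq> {})"

definition independent_set :: "'a set set \<Rightarrow> 'a set \<Rightarrow> bool" where
  "independent_set E S \<longleftrightarrow> (\<forall>u\<in>S. \<forall>v\<in>S. {u, v} \<notin> E)"

definition edge_cover :: "'a set \<Rightarrow> 'a set set \<Rightarrow> 'a set set \<Rightarrow> bool" where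
  "edge_cover V E C \<longleftrightarrow> C \<subseteq> E \<and> (\<forall>v\<in>V. \<exists>e\<in>C. v \<in> e)"

definition edge_cover_number :: "'a set \<Rightarrow> 'a set set \<Rightarrow> nat" where
  "edge_cover_number V E = (LEAST n. \<exists>C. edge_cover V E C \<and> card C = n)"

text \<open>Vertex labellings are total functions; only their values on the vertex set matter.\<close>

definition IDRDF :: "'a set \<Rightarrow> 'a set set \<Rightarrow> ('a \<Rightarrow> nat) \<Rightarrow> bool" where
  "IDRDF V E f \<longleftrightarrow>
     (\<forall>v\<in>V. f v \<in> {0, 1, 2, 3}) \<and>
     (\<forall>v\<in>V. f v = 0 \<longrightarrow>
        card {w \<in> nbrs E v. f w = 2} \<ge> 2 \<or> (\<exists>w\<in>nbrs E v. f w = 3)) \<and>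
     (\<forall>v\<in>V. f v = 1 \<longrightarrow> (\<exists>w\<in>nbrs E v. f w \<ge> 2)) \<and>
     independent_set E {v \<in> V. f v > 0}"

definition i_dR :: "'a set \<Rightarrow> 'a set set \<Rightarrow> nat" where
  "i_dR V E = (LEAST n. \<exists>f. IDRDF V E f \<and> (\<Sum>v\<in>V. f v) = n)"

definition R2DF :: "'a set \<Rightarrow> 'a set set \<Rightarrow> ('a \<Rightarrow> nat) \<Rightarrow> bool" where
  "R2DF V E g \<longleftrightarrow>
     (\<forall>v\<in>V. g v \<in> {0, 1, 2}) \<and>
     (\<forall>v\<in>V. g v = 0 \<longrightarrow> (\<Sum>u\<in>nbrs E v. g u) \<ge> 2)"

definition independent_R2DF :: "'a set \<Rightarrow> 'a set set \<Rightarrow> ('a \<Rightarrow> nat) \<Rightarrow> bool" where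
  "independent_R2DF V E g \<longleftrightarrow> R2DF V E g \<and> independent_set E {v \<in> V. g v > 0}"

definition i_R2 :: "'a set \<Rightarrow> 'a set set \<Rightarrow> nat" where
  "i_R2 V E = (LEAST n. \<exists>g. independent_R2DF V E g \<and> (\<Sum>v\<in>V. g v) = n)"

end

theory Submission
  imports Defs
begin

text \<open>Raising every positive label of an independent Roman {2}-dominating function \<open>g\<close> by one
  gives an independent double Roman dominating function. This adds the size of the support of \<open>g\<close>
  to the weight; the support is independent, so an edge cover needs a separate edge for each of its
  vertices. The complete graph on two vertices attains equality, with \<open>3 = 2 + 1\<close>.\<close>

lemma nbrs_subset: "fin_graph V E \<Longrightarrow> nbrs E v \<subseteq> V"
  unfolding fin_graph_def nbrs_def by blast

lemma finite_nbrs: "fin_graph V E \<Longrightarrow> finite (nbrs E v)"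
  using nbrs_subset[of V E v] finite_subset[of "nbrs E v" V] by (simp add: fin_graph_def)

lemma no_loop: "fin_graph V E \<Longrightarrow> {v, v} \<notin> E"
  unfolding fin_graph_def by force

text \<open>A vertex outside a maximal independent set and with no neighbour in it could be added to
  it. So such a set is dominating, which is what a labelling supported on it needs.\<close>

lemma ex_maximal_independent_set:
  assumes G: "fin_graph V E"
  obtains S where "S \<subseteq> V" "independent_set E S" "\<And>v. v \<in> V - S \<Longrightarrow> \<exists>w\<in>S. {v, w} \<in> E"
proof -
  let ?I = "{S. S \<subseteq> V \<and> independent_set E S}"
  have "finite ?I" using G unfolding fin_graph_def by simp
  moreover have "{} \<in> ?I" by (simp add: independent_set_def)
  ultimately obtain S where "S \<in> ?I" and "\<forall>T\<in>?I. S \<subseteq> T \<longrightarrow> S = T"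
    using finite_has_maximal[of ?I] by (metis empty_iff)
  hence S: "S \<subseteq> V" "independent_set E S"
    and max: "\<And>T. T \<subseteq> V \<Longrightarrow> independent_set E T \<Longrightarrow> S \<subseteq> T \<Longrightarrow> S = T"
    by simp_all
  have "\<exists>w\<in>S. {v, w} \<in> E" if v: "v \<in> V - S" for v
  proof (rule ccontr)
    assume "\<not> (\<exists>w\<in>S. {v, w} \<in> E)"
    \<comment> \<open>\<open>independent_set\<close> also tests the pair of \<open>v\<close> with
      itself, so the absence of loops enters here.\<close>
    hence "independent_set E (insert v S)"
      using S(2) no_loop[OF G] unfolding independent_set_def by (auto simp: insert_commute)
    thus False using max[of "insert v S"] S(1) v by auto
  qed
  thus thesis using that S by blast
qed

text \<open>The label 2 on a maximal independent set works. Existence ensures that the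
  \<open>LEAST\<close> in \<open>i_R2\<close> is attained.\<close>

lemma ex_independent_R2DF:
  assumes G: "fin_graph V E"
  shows "\<exists>g. independent_R2DF V E g"
proof -
  obtain S where S: "S \<subseteq> V" "independent_set E S"
    and dom: "\<And>v. v \<in> V - S \<Longrightarrow> \<exists>w\<in>S. {v, w} \<in> E"
    using ex_maximal_independent_set[OF G] by blast
  define g :: "'a \<Rightarrow> nat" where "g v = (if v \<in> S then 2 else 0)" for v
  have "(\<Sum>u\<in>nbrs E v. g u) \<ge> 2" if v: "v \<in> V" "g v = 0" for v
  proof -
    obtain w where w: "w \<in> S" "{v, w} \<in> E"
      using dom[of v] v by (auto simp: g_def split: if_splits)
    hence "g w \<le> (\<Sum>u\<in>nbrs E v. g u)"
      by (intro member_le_sum finite_nbrs[OF G]) (auto simp: nbrs_def)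
    thus ?thesis using w by (simp add: g_def)
  qed
  moreover have "{v \<in> V. g v > 0} = S" using S(1) by (auto simp: g_def)
  ultimately have "independent_R2DF V E g"
    using S(2) by (auto simp: independent_R2DF_def R2DF_def g_def)
  thus ?thesis by blast
qed

text \<open>Choose a covering edge for each vertex of \<open>S\<close>. Two vertices with the same
  choice would be the two ends of that edge, against independence, so the choice is
  injective.\<close>

lemma card_independent_set_le_edge_cover:
  assumes C: "edge_cover V E C" "finite C" and S: "S \<subseteq> V" "independent_set E S"
    and G: "fin_graph V E"
  shows "card S \<le> card C"
proof -
  have "\<forall>v\<in>S. \<exists>e\<in>C. v \<in> e" using C(1) S(1) unfolding edge_cover_def by blast
  then obtain e where e: "\<And>v. v \<in> S \<Longrightarrow> e v \<in> C" "\<And>v. v \<in> S \<Longrightarrow> v \<in> e v" by metis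
  have "inj_on e S"
  proof (rule inj_onI, rule ccontr)
    fix u v assume uv: "u \<in> S" "v \<in> S" "e u = e v" "u \<noteq> v"
    hence sub: "{u, v} \<subseteq> e u" using e(2) by force
    have E: "e u \<in> E" using e(1) uv(1) C(1) unfolding edge_cover_def by blast
    hence c: "card (e u) = 2" using G unfolding fin_graph_def by blast
    have "{u, v} = e u"
      using sub c uv(4) by (intro card_subset_eq) (auto intro: card_ge_0_finite)
    thus False using E S(2) uv(1,2) unfolding independent_set_def by metis
  qed
  thus ?thesis using e(1) C(2) by (intro card_inj_on_le) auto
qed

text \<open>The support does not change, and no vertex gets label 1. For a vertex with label 0,
  either some neighbour had label 2 and now has 3, or all its neighbours had labels at most 1; then
  at least two of them had 1 and now have 2.\<close>

lemma IDRDF_raise_independent_R2DF: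
  assumes G: "fin_graph V E" and g: "independent_R2DF V E g"
  shows "IDRDF V E (\<lambda>v. if g v > 0 then Suc (g v) else 0)" (is "IDRDF V E ?f")
proof -
  have val: "g v \<in> {0, 1, 2}" if "v \<in> V" for v
    using g that unfolding independent_R2DF_def R2DF_def by blast
  have "card {w \<in> nbrs E v. ?f w = 2} \<ge> 2 \<or> (\<exists>w\<in>nbrs E v. ?f w = 3)"
    if v: "v \<in> V" "?f v = 0" for v
  proof (cases "\<exists>w\<in>nbrs E v. g w = 2")
    case True
    thus ?thesis by force
  next
    case False
    have two: "(\<Sum>u\<in>nbrs E v. g u) \<ge> 2"
      using g v unfolding independent_R2DF_def R2DF_def by (auto split: if_splits)
    have le1: "g w = 0 \<or> g w = 1" if "w \<in> nbrs E v" for w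
      using val[of w] that False nbrs_subset[OF G, of v] by auto
    \<comment> \<open>With labels 0 and 1 only, the sum counts the neighbours with label 1, which
      are those raised to 2.\<close>
    have "(\<Sum>u\<in>nbrs E v. g u) = (\<Sum>u\<in>nbrs E v. if ?f u = 2 then 1 else 0)"
      using le1 by (intro sum.cong) force+
    also have "\<dots> = card {w \<in> nbrs E v. ?f w = 2}"
      using finite_nbrs[OF G] by (simp add: sum.If_cases Int_def)
    finally show ?thesis using two by simp
  qed
  moreover have "?f v \<in> {0, 1, 2, 3}" if "v \<in> V" for v
    using val[OF that] by auto
  moreover have "?f v \<noteq> 1" for v by simp
  moreover have "independent_set E {v \<in> V. ?f v > 0}"
    using g unfolding independent_R2DF_def independent_set_def by simp
  ultimately show ?thesis
    unfolding IDRDF_def by blast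
qed

text \<open>The existence claim is kept as a separate conclusion because a lower bound on weights
  transfers to \<open>i_dR\<close> only if some function attains that minimum.\<close>

lemma i_dR_le_i_R2_plus_edge_cover_number:
  assumes G: "fin_graph V E" and iso: "no_isolated V E"
  shows "\<exists>f. IDRDF V E f" "i_dR V E \<le> i_R2 V E + edge_cover_number V E"
proof -
  have finV: "finite V" using G unfolding fin_graph_def by simp
  have "E \<subseteq> Pow V" using G unfolding fin_graph_def by blast
  \<comment> \<open>This makes every edge cover finite; \<open>card\<close> of an infinite set would
    be the default 0.\<close>
  hence finE: "finite E" using finV finite_subset by blast
  obtain g where g: "independent_R2DF V E g" and gw: "(\<Sum>v\<in>V. g v) = i_R2 V E"
    using LeastI_ex[of "\<lambda>n. \<exists>g. independent_R2DF V E g \<and> (\<Sum>v\<in>V. g v) = n"]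
      ex_independent_R2DF[OF G] unfolding i_R2_def by blast
  \<comment> \<open>Without isolated vertices the set of all edges is a cover, so the minimum in
    \<open>edge_cover_number\<close> is attained.\<close>
  have "edge_cover V E E"
    using iso unfolding edge_cover_def no_isolated_def nbrs_def by blast
  then obtain C where C: "edge_cover V E C" and Cn: "card C = edge_cover_number V E"
    using LeastI_ex[of "\<lambda>n. \<exists>C. edge_cover V E C \<and> card C = n"]
    unfolding edge_cover_number_def by blast
  define f where "f v = (if g v > 0 then Suc (g v) else 0)" for v
  have f: "IDRDF V E f" using IDRDF_raise_independent_R2DF[OF G g] by (simp add: f_def[abs_def])
  thus "\<exists>f. IDRDF V E f" by blast
  have "(\<Sum>v\<in>V. f v) = (\<Sum>v\<in>V. g v + (if g v > 0 then 1 else 0))"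
    by (intro sum.cong) (auto simp: f_def)
  also have "\<dots> = (\<Sum>v\<in>V. g v) + card {v \<in> V. g v > 0}"
    using finV by (simp add: sum.distrib sum.If_cases Int_def)
  also have "card {v \<in> V. g v > 0} \<le> card C"
    using C g G finE finite_subset unfolding independent_R2DF_def
    by (intro card_independent_set_le_edge_cover[of V E]) (auto simp: edge_cover_def)
  finally have "(\<Sum>v\<in>V. f v) \<le> i_R2 V E + edge_cover_number V E" using gw Cn by simp
  moreover have "i_dR V E \<le> (\<Sum>v\<in>V. f v)"
    unfolding i_dR_def using f by (intro Least_le) blast
  ultimately show "i_dR V E \<le> i_R2 V E + edge_cover_number V E" by simp
qed

text \<open>The general inequality is squeezed: \<open>i_dR\<close> is at least 3, while
  \<open>i_R2\<close> is at most 2 and the edge cover number at most 1.\<close>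

lemma K2_attains_bound:
  fixes a b :: 'a
  assumes ab: "a \<noteq> b"
  defines "V \<equiv> {a, b}" and "E \<equiv> {{a, b}}"
  shows "fin_graph V E" "no_isolated V E" "i_dR V E = i_R2 V E + edge_cover_number V E"
proof -
  show G: "fin_graph V E" using ab by (simp add: fin_graph_def V_def E_def)
  have Na: "nbrs E a = {b}" and Nb: "nbrs E b = {a}"
    using ab by (auto simp: nbrs_def E_def doubleton_eq_iff)
  thus iso: "no_isolated V E" by (auto simp: no_isolated_def V_def)
  have ge3: "(\<Sum>v\<in>V. f v) \<ge> 3" if f: "IDRDF V E f" for f
  proof -
    \<comment> \<open>A vertex with a single neighbour cannot have two neighbours labelled 2, so
      label 0 forces a 3 next to it.\<close>
    have zero: "f w = 3" if "v \<in> V" "nbrs E v = {w}" "f v = 0" for v w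
    proof -
      have "card {u \<in> nbrs E v. f u = 2} \<le> card {w}"
        using that(2) by (intro card_mono) auto
      thus ?thesis using f that unfolding IDRDF_def by auto
    qed
    have "f a = 0 \<or> f b = 0"
    proof (rule ccontr)
      assume "\<not> ?thesis"
      hence "a \<in> {v \<in> V. f v > 0}" "b \<in> {v \<in> V. f v > 0}" by (simp_all add: V_def)
      thus False using f unfolding IDRDF_def independent_set_def E_def by blast
    qed
    moreover have "f a = 0 \<Longrightarrow> f b = 3" by (rule zero[OF _ Na]) (simp_all add: V_def)
    moreover have "f b = 0 \<Longrightarrow> f a = 3" by (rule zero[OF _ Nb]) (simp_all add: V_def)
    moreover have "(\<Sum>v\<in>V. f v) = f a + f b" using ab by (simp add: V_def)
    ultimately show ?thesis by linarith
  qed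
  obtain f where "IDRDF V E f" "(\<Sum>v\<in>V. f v) = i_dR V E"
    using LeastI_ex[of "\<lambda>n. \<exists>f. IDRDF V E f \<and> (\<Sum>v\<in>V. f v) = n"]
      i_dR_le_i_R2_plus_edge_cover_number(1)[OF G iso] unfolding i_dR_def by blast
  hence "i_dR V E \<ge> 3" using ge3 by metis
  moreover have "i_R2 V E \<le> 2"
  proof -
    define g :: "'a \<Rightarrow> nat" where "g v = (if v = a then 2 else 0)" for v
    have "{v \<in> V. g v > 0} = {a}" by (auto simp: V_def g_def)
    hence "independent_R2DF V E g"
      using Nb no_loop[OF G]
      by (auto simp: independent_R2DF_def R2DF_def independent_set_def V_def g_def)
    moreover have "(\<Sum>v\<in>V. g v) = 2" using ab by (simp add: V_def g_def)
    ultimately show ?thesis unfolding i_R2_def by (intro Least_le) blast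
  qed
  moreover have "edge_cover_number V E \<le> 1"
    unfolding edge_cover_number_def
    by (intro Least_le exI[of _ E]) (auto simp: edge_cover_def V_def E_def)
  ultimately show "i_dR V E = i_R2 V E + edge_cover_number V E"
    using i_dR_le_i_R2_plus_edge_cover_number(2)[OF G iso] by linarith
qed

theorem theorem10:
  "(\<forall>(V :: 'a set) E. fin_graph V E \<and> no_isolated V E \<longrightarrow>
      i_dR V E \<le> i_R2 V E + edge_cover_number V E) \<and>
   (\<exists>(V :: nat set) E. V \<noteq> {} \<and> fin_graph V E \<and> no_isolated V E \<and>
      i_dR V E = i_R2 V E + edge_cover_number V E)"
proof (intro conjI allI impI)
  fix V :: "'a set" and E
  assume "fin_graph V E \<and> no_isolated V E"
  thus "i_dR V E \<le> i_R2 V E + edge_cover_number V E"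
    using i_dR_le_i_R2_plus_edge_cover_number(2) by blast
next
  \<comment> \<open>The example needs two distinct vertices, which \<open>nat\<close> supplies; the
    type \<open>'a\<close> might have only one element.\<close>
  have "(0::nat) \<noteq> 1" by simp
  note K2 = K2_attains_bound[OF this]
  show "\<exists>(V :: nat set) E. V \<noteq> {} \<and> fin_graph V E \<and> no_isolated V E \<and>
      i_dR V E = i_R2 V E + edge_cover_number V E"
    by (rule exI[of _ "{0, 1}"], rule exI[of _ "{{0, 1}}"]) (intro conjI insert_not_empty K2)
qed

end
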